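(* Let $\Gamma\subset\mathbb{C}$ be a simple closed curve, $D=\Gamma\cup\operatorname{Int}(\Gamma)$, and let $f\in\mathcal{M}(D)$. Then $f$ is Gateaux differentiable in $\mathcal{M}(D)$ if and only if $M_{f_Q}\times M_{f_R}$ is a singleton.
   Context: $\Gamma$ is a simple closed curve in $\mathbb{C}$, $\operatorname{Int}(\Gamma)$ is the bounded region it encloses, and $D:=\Gamma\cup\operatorname{Int}(\Gamma)$ (a compact set). $\mathcal{M}(D)$ is the complex vector space of all meromorphic functions on $D$ under the usual operations (as usual, meromorphic/analytic on the closed set $D$ means meromorphic/analytic on some open neighbourhood of $D$, functions agreeing on $D$ being identified). For $f\in\mathcal{M}(D)$, let $z_i\in D$ be its (finitely many) poles in $D$, of order $n_i$, and let $\sum_{j=1}^{n_i}\frac{a_{ij}}{(z-z_i)^j}$ be the principal part of $f$ at $z_i$. Put $$f_P(z):=\sum_{z_i\in D}\sum_{j=1}^{n_i}\frac{a_{ij}}{(z-z_i)^j},\qquad f_R(z):=f(z)-f_P(z),\qquad f_Q(z):=\sum_{z_i\in D}\sum_{j=1}^{n_i}a_{ij}(z-z_i)^j .$$ Thus $f_R$ is analytic on $D$ and $f_Q$ is a polynomial (both sums are $0$ if $f$ has no pole in $D$). Define $$\|f_Q\|:=\sup_{z\in D}|f_Q(z)|,\quad \|f_R\|:=\sup_{z\in D}|f_R(z)|,\quad \|f\|:=\|f_Q\|+\|f_R\|,$$ which is the norm used on $\mathcal{M}(D)$, and $$M_{f_Q}:=\{z\in D:|f_Q(z)|=\|f_Q\|\},\qquad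 M_{f_R}:=\{z\in D:|f_R(z)|=\|f_R\|\}.$$ An element $f\in\mathcal{M}(D)$ is Gateaux differentiable in $\mathcal{M}(D)$ if $f\neq0$ and for every $g\in\mathcal{M}(D)$ the limit $\lim_{t\to0}\frac{\|f+tg\|-\|f\|}{t}$ ($t$ real) exists and is finite. *)

theory Defs
  imports "HOL-Complex_Analysis.Complex_Analysis"
begin

text \<open>
  An element of the space M(D) is represented by a total function \<^term>\<open>f\<close> with
  \<^term>\<open>f meromorphic_on D\<close>: the library predicate asks for a Laurent expansion at every point
  of \<^term>\<open>D\<close>, hence makes \<^term>\<open>f\<close> meromorphic on an open neighbourhood of \<^term>\<open>D\<close>, and
  leaves the value of \<^term>\<open>f\<close> at poles (and at other isolated points) arbitrary.
  All notions below depend only on punctured germs, so they do not see these values.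
\<close>

text \<open>Equality in M(D): agreement on \<^term>\<open>D\<close> up to the arbitrary values just mentioned.\<close>

definition mero_eq :: "complex set \<Rightarrow> (complex \<Rightarrow> complex) \<Rightarrow> (complex \<Rightarrow> complex) \<Rightarrow> bool" where
  "mero_eq D f g \<longleftrightarrow> {z \<in> D. f z \<noteq> g z} sparse_in D"

definition poles_in :: "complex set \<Rightarrow> (complex \<Rightarrow> complex) \<Rightarrow> complex set" where
  "poles_in D f = {z \<in> D. is_pole f z}"

text \<open>The library's \<^const>\<open>zorder\<close> is negative at a pole.\<close>

definition pole_order :: "(complex \<Rightarrow> complex) \<Rightarrow> complex \<Rightarrow> nat" where
  "pole_order f w = nat (- zorder f w)"

definition pp_coeff :: "(complex \<Rightarrow> complex) \<Rightarrow> complex \<Rightarrow> nat \<Rightarrow> complex" where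
  "pp_coeff f w j = fls_nth (laurent_expansion f w) (- int j)"

definition mero_P :: "complex set \<Rightarrow> (complex \<Rightarrow> complex) \<Rightarrow> complex \<Rightarrow> complex" where
  "mero_P D f z = (\<Sum>w\<in>poles_in D f. \<Sum>j=1..pole_order f w. pp_coeff f w j / (z - w) ^ j)"

text \<open>\<^const>\<open>remove_sings\<close> fills in the removable singularities that are left over at the poles
  of \<^term>\<open>f\<close>.\<close>

definition mero_R :: "complex set \<Rightarrow> (complex \<Rightarrow> complex) \<Rightarrow> complex \<Rightarrow> complex" where
  "mero_R D f = remove_sings (\<lambda>z. f z - mero_P D f z)"

definition mero_Q :: "complex set \<Rightarrow> (complex \<Rightarrow> complex) \<Rightarrow> complex \<Rightarrow> complex" where
  "mero_Q D f z = (\<Sum>w\<in>poles_in D f. \<Sum>j=1..pole_order f w. pp_coeff f w j * (z - w) ^ j)"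

definition sup_norm :: "complex set \<Rightarrow> (complex \<Rightarrow> complex) \<Rightarrow> real" where
  "sup_norm D h = (SUP z\<in>D. norm (h z))"

definition mero_norm :: "complex set \<Rightarrow> (complex \<Rightarrow> complex) \<Rightarrow> real" where
  "mero_norm D f = sup_norm D (mero_Q D f) + sup_norm D (mero_R D f)"

definition max_modulus_set :: "complex set \<Rightarrow> (complex \<Rightarrow> complex) \<Rightarrow> complex set" where
  "max_modulus_set D h = {z \<in> D. norm (h z) = sup_norm D h}"

definition gateaux_differentiable_mero :: "complex set \<Rightarrow> (complex \<Rightarrow> complex) \<Rightarrow> bool" where
  "gateaux_differentiable_mero D f \<longleftrightarrow>
     \<not> mero_eq D f (\<lambda>z. 0) \<and>
     (\<forall>g. g meromorphic_on D \<longrightarrow>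
        (\<exists>L::real. ((\<lambda>t::real. (mero_norm D (\<lambda>z. f z + complex_of_real t * g z) - mero_norm D f) / t)
                     \<longlongrightarrow> L) (at 0)))"

end

theory Submission
  imports Defs
begin

text \<open>
  The maps \<open>f \<mapsto> f\<^sub>Q\<close> and \<open>f \<mapsto> f\<^sub>R\<close> are linear, so the norm splits into two supremum norms.
  If \<open>F\<close> attains its maximum modulus on a compact set only at \<open>z\<^sub>0\<close>, then the maximizers of
  \<open>F + t h\<close> tend to \<open>z\<^sub>0\<close> as \<open>t\<close> tends to \<open>0\<close>, and the difference quotient of the supremum norm is
  squeezed between difference quotients of the modulus at \<open>z\<^sub>0\<close> and at these maximizers.
  If there are two maximum points \<open>z\<^sub>1 \<noteq> z\<^sub>2\<close>, then for a suitable \<open>c\<close> the direction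
  \<open>h(z) = c (z - z\<^sub>2)\<close> has right quotients at least \<open>1\<close> (look at \<open>z\<^sub>1\<close>) and left quotients at most
  \<open>0\<close> (look at \<open>z\<^sub>2\<close>). This direction is available in both components: it is \<open>g\<^sub>Q\<close> for
  \<open>g(z) = c / (z - z\<^sub>2)\<close>, where \<open>g\<^sub>R = 0\<close>, and it is \<open>g\<^sub>R\<close> for \<open>g = h\<close>, where \<open>g\<^sub>Q = 0\<close>.
\<close>

subsection \<open>Directional derivatives of the supremum norm\<close>

lemma bdd_above_norm_image:
  fixes F :: "complex \<Rightarrow> complex"
  assumes "compact K" "continuous_on K F"
  shows "bdd_above ((\<lambda>z. norm (F z)) ` K)"
  using assms by (intro bounded_imp_bdd_above compact_imp_bounded compact_continuous_image
      continuous_on_norm)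

lemma norm_le_sup_norm:
  assumes "compact K" "continuous_on K F" "z \<in> K"
  shows "norm (F z) \<le> sup_norm K F"
  unfolding sup_norm_def
  using assms bdd_above_norm_image by (intro cSUP_upper) auto

lemma sup_norm_attained:
  assumes "compact K" "K \<noteq> {}" "continuous_on K F"
  obtains z where "z \<in> K" "norm (F z) = sup_norm K F"
proof -
  have "continuous_on K (\<lambda>z. norm (F z))"
    using assms by (intro continuous_on_norm)
  from continuous_attains_sup[OF assms(1,2) this]
  obtain z where z: "z \<in> K" "\<forall>y\<in>K. norm (F y) \<le> norm (F z)" by blast
  have "sup_norm K F \<le> norm (F z)"
    unfolding sup_norm_def using z assms(2) by (intro cSUP_least) auto
  with norm_le_sup_norm[OF assms(1,3) z(1)] z(1) that show thesis by force
qed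

lemma max_modulus_set_nonempty:
  assumes "compact K" "K \<noteq> {}" "continuous_on K F"
  shows "max_modulus_set K F \<noteq> {}"
  using sup_norm_attained[OF assms] unfolding max_modulus_set_def by blast

lemma sup_norm_cong: "(\<And>z. z \<in> K \<Longrightarrow> F z = G z) \<Longrightarrow> sup_norm K F = sup_norm K G"
  unfolding sup_norm_def by (intro SUP_cong) auto

text \<open>For the zero function every point is a maximizer. On a nonempty set without isolated
  points, a unique maximizer therefore excludes the zero function.\<close>

lemma max_modulus_set_eq_zero:
  assumes "\<And>z. z \<in> K \<Longrightarrow> F z = 0"
  shows "max_modulus_set K F = K"
proof (cases "K = {}")
  case False
  have "sup_norm K F = 0"
    using assms False unfolding sup_norm_def by (simp cong: SUP_cong)
  with assms show ?thesis by (auto simp: max_modulus_set_def)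
qed (simp add: max_modulus_set_def)

text \<open>The quotient on the right is used because it is jointly continuous in \<open>a\<close>, \<open>b\<close> and
  \<open>t\<close> as long as \<open>a \<noteq> 0\<close>.\<close>

lemma norm_add_scaled_quotient:
  fixes a b :: complex and t :: real
  assumes "a \<noteq> 0" "t \<noteq> 0"
  shows "(norm (a + of_real t * b) - norm a) / t
    = (2 * Re (cnj a * b) + t * (norm b)\<^sup>2) / (norm (a + of_real t * b) + norm a)"
proof -
  have pos: "norm (a + of_real t * b) + norm a > 0"
    using assms(1) by (simp add: add_nonneg_pos)
  \<comment> \<open>Multiplying by the sum of the moduli turns their difference into a difference of
    squares, which is polynomial in \<open>t\<close>.\<close>
  have "(norm (a + of_real t * b) - norm a) * (norm (a + of_real t * b) + norm a)
      = (norm (a + of_real t * b))\<^sup>2 - (norm a)\<^sup>2"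
    by (simp add: algebra_simps power2_eq_square)
  also have "\<dots> = t * (2 * Re (cnj a * b) + t * (norm b)\<^sup>2)"
    by (simp add: cmod_power2) (simp add: algebra_simps power2_eq_square)
  finally show ?thesis
    using pos assms(2) by (simp add: field_simps)
qed

text \<open>Off an open neighbourhood \<open>U\<close> of \<open>z0\<close>, the maximum modulus on
  the compact set \<open>K - U\<close> is strictly below \<open>sup_norm K F\<close>, so moduli
  close to \<open>sup_norm K F\<close> force the points into \<open>U\<close>.\<close>

lemma tendsto_unique_maximizer:
  assumes K: "compact K" and F: "continuous_on K F"
    and max: "max_modulus_set K F = {z0}"
    and m: "\<And>x. m x \<in> K" and lim: "((\<lambda>x. norm (F (m x))) \<longlongrightarrow> sup_norm K F) X"
  shows "(m \<longlongrightarrow> z0) X"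
proof (rule topological_tendstoI)
  fix U assume U: "open U" "z0 \<in> U"
  show "eventually (\<lambda>x. m x \<in> U) X"
  proof (cases "K - U = {}")
    case True
    with m show ?thesis by (intro always_eventually) blast
  next
    case False
    have KU: "compact (K - U)" "continuous_on (K - U) F"
      using K U F by (auto intro: compact_diff continuous_on_subset)
    from sup_norm_attained[OF KU(1) False KU(2)] obtain y
      where y: "y \<in> K - U" "norm (F y) = sup_norm (K - U) F" .
    have "y \<notin> max_modulus_set K F" using max U(2) y(1) by auto
    with y(1) have "norm (F y) \<noteq> sup_norm K F" by (simp add: max_modulus_set_def)
    with norm_le_sup_norm[OF K F] y have "sup_norm (K - U) F < sup_norm K F"
      by force
    from order_tendstoD(1)[OF lim this] show ?thesis
    proof eventually_elim
      case (elim x)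
      then show ?case
        using norm_le_sup_norm[OF KU, of "m x"] m by force
    qed
  qed
qed

text \<open>The limit is the derivative at \<open>t = 0\<close> of the modulus of
  \<open>F z0 + of_real t * h z0\<close>; the condition \<open>F z0 \<noteq> 0\<close> keeps the
  modulus differentiable there.\<close>

lemma sup_norm_directional_derivative:
  fixes F h :: "complex \<Rightarrow> complex"
  assumes K: "compact K" and F: "continuous_on K F" and h: "continuous_on K h"
    and max: "max_modulus_set K F = {z0}" and nz: "F z0 \<noteq> 0"
  shows "((\<lambda>t. (sup_norm K (\<lambda>z. F z + of_real t * h z) - sup_norm K F) / t)
    \<longlongrightarrow> Re (cnj (F z0) * h z0) / norm (F z0)) (at (0::real))"
proof -
  define N where "N t = sup_norm K (\<lambda>z. F z + of_real t * h z)" for t :: real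
  \<comment> \<open>\<open>q\<close> is the difference quotient of the modulus at a fixed point, and
    \<open>r\<close> is its rationalized form, whose limit can be read off even along the moving
    point \<open>m t\<close>.\<close>
  define q where "q z t = (norm (F z + of_real t * h z) - norm (F z)) / t" for z and t :: real
  define r where "r z t = (2 * Re (cnj (F z) * h z) + t * (norm (h z))\<^sup>2)
      / (norm (F z + of_real t * h z) + norm (F z))" for z and t :: real
  have z0: "z0 \<in> K" "norm (F z0) = sup_norm K F"
    using max unfolding max_modulus_set_def by auto
  have cont: "continuous_on K (\<lambda>z. F z + of_real t * h z)" for t :: real
    by (intro continuous_intros F h)
  have "\<exists>z. z \<in> K \<and> norm (F z + of_real t * h z) = N t" for t :: real
    using sup_norm_attained[OF K _ cont] z0(1) unfolding N_def by blast
  then obtain m where m: "\<And>t. m t \<in> K" "\<And>t. norm (F (m t) + of_real t * h (m t)) = N t"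
    by metis
  define H where "H = sup_norm K h"
  have hH: "norm (h z) \<le> H" if "z \<in> K" for z
    unfolding H_def using norm_le_sup_norm[OF K h that] .
  have NU: "norm (F z + of_real t * h z) \<le> N t" if "z \<in> K" for z and t :: real
    unfolding N_def using norm_le_sup_norm[OF K cont that] .
  have FU: "norm (F z) \<le> sup_norm K F" if "z \<in> K" for z
    using norm_le_sup_norm[OF K F that] .
  have th: "norm (of_real t * h z) \<le> \<bar>t\<bar> * H" if "z \<in> K" for z and t :: real
    using hH[OF that] by (simp add: norm_mult mult_left_mono)
  \<comment> \<open>The perturbation changes a modulus by at most \<open>\<bar>t\<bar> * H\<close>.
    This is paid once at \<open>z0\<close> and once at \<open>m t\<close>, hence the factor
    2.\<close>
  have "((\<lambda>t. norm (F (m t))) \<longlongrightarrow> sup_norm K F) (at 0)"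
  proof (rule tendsto_sandwich)
    show "eventually (\<lambda>t. sup_norm K F - 2 * \<bar>t\<bar> * H \<le> norm (F (m t))) (at 0)"
    proof (intro always_eventually allI)
      fix t :: real
      have "norm (F z0) - norm (of_real t * h z0) \<le> N t"
        using NU[OF z0(1), of t] norm_diff_ineq[of "F z0" "of_real t * h z0"] by linarith
      moreover have "N t \<le> norm (F (m t)) + norm (of_real t * h (m t))"
        using m(2)[of t] norm_triangle_ineq by metis
      ultimately show "sup_norm K F - 2 * \<bar>t\<bar> * H \<le> norm (F (m t))"
        using th[OF z0(1), of t] th[OF m(1)[of t], of t] z0(2) by linarith
    qed
    show "eventually (\<lambda>t. norm (F (m t)) \<le> sup_norm K F) (at 0)"
      using FU m(1) by (intro always_eventually) blast
  qed (auto intro!: tendsto_eq_intros)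
  from tendsto_unique_maximizer[OF K F max m(1) this] have mlim: "(m \<longlongrightarrow> z0) (at 0)" .
  have Flim: "((\<lambda>t. F (m t)) \<longlongrightarrow> F z0) (at 0)" and hlim: "((\<lambda>t. h (m t)) \<longlongrightarrow> h z0) (at 0)"
    using continuous_on_tendsto_compose[OF F mlim z0(1)]
      continuous_on_tendsto_compose[OF h mlim z0(1)] m(1) by auto
  have rlim: "((\<lambda>t. r (m t) t) \<longlongrightarrow> Re (cnj (F z0) * h z0) / norm (F z0)) (at 0)"
    unfolding r_def
    by (rule tendsto_eq_intros Flim hlim refl | use nz in \<open>simp; fail\<close>)+
      (use nz in \<open>simp add: field_simps\<close>)
  have rlim0: "((\<lambda>t. r z0 t) \<longlongrightarrow> Re (cnj (F z0) * h z0) / norm (F z0)) (at 0)"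
    unfolding r_def
    by (rule tendsto_eq_intros refl | use nz in \<open>simp; fail\<close>)+
      (use nz in \<open>simp add: field_simps\<close>)
  \<comment> \<open>Rationalizing requires a nonzero value of \<open>F\<close>; at
    \<open>m t\<close> this is guaranteed for \<open>t\<close> near 0.\<close>
  have "eventually (\<lambda>t. F (m t) \<noteq> 0) (at 0)"
    using Flim nz tendsto_imp_eventually_ne by blast
  moreover have "eventually (\<lambda>t::real. t \<noteq> 0) (at 0)"
    by (simp add: eventually_at_filter)
  ultimately have qr: "eventually (\<lambda>t. t \<noteq> 0 \<and> q (m t) t = r (m t) t \<and> q z0 t = r z0 t) (at 0)"
    by eventually_elim (simp add: q_def r_def nz norm_add_scaled_quotient)
  have q1: "((\<lambda>t. q (m t) t) \<longlongrightarrow> Re (cnj (F z0) * h z0) / norm (F z0)) (at 0)"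
    by (rule Lim_transform_eventually[OF rlim]) (use qr in \<open>auto elim: eventually_mono\<close>)
  have q2: "((\<lambda>t. q z0 t) \<longlongrightarrow> Re (cnj (F z0) * h z0) / norm (F z0)) (at 0)"
    by (rule Lim_transform_eventually[OF rlim0]) (use qr in \<open>auto elim: eventually_mono\<close>)
  \<comment> \<open>The point \<open>z0\<close> bounds the increment of the norm from below and
    \<open>m t\<close> bounds it from above. Dividing by a negative \<open>t\<close> swaps the two
    bounds, hence \<open>min\<close> and \<open>max\<close>.\<close>
  have between: "min (q z0 t) (q (m t) t) \<le> (N t - sup_norm K F) / t
      \<and> (N t - sup_norm K F) / t \<le> max (q z0 t) (q (m t) t)" if "t \<noteq> 0" for t :: real
  proof -
    have a: "norm (F z0 + of_real t * h z0) - norm (F z0) \<le> N t - sup_norm K F"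
      using NU[OF z0(1), of t] z0(2) by simp
    have b: "N t - sup_norm K F \<le> norm (F (m t) + of_real t * h (m t)) - norm (F (m t))"
      using m(2)[of t] FU[OF m(1)[of t]] by simp
    show ?thesis
    proof (cases "t > 0")
      case True
      with a b have "q z0 t \<le> (N t - sup_norm K F) / t" "(N t - sup_norm K F) / t \<le> q (m t) t"
        unfolding q_def by (auto intro: divide_right_mono)
      then show ?thesis by auto
    next
      case False
      with that a b have "q z0 t \<ge> (N t - sup_norm K F) / t" "(N t - sup_norm K F) / t \<ge> q (m t) t"
        unfolding q_def by (auto intro: divide_right_mono_neg)
      then show ?thesis by auto
    qed
  qed
  show ?thesis
    unfolding N_def[symmetric]
  proof (rule tendsto_sandwich)
    show "((\<lambda>t. min (q z0 t) (q (m t) t)) \<longlongrightarrow> Re (cnj (F z0) * h z0) / norm (F z0)) (at 0)"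
      using tendsto_min[OF q2 q1] by simp
    show "((\<lambda>t. max (q z0 t) (q (m t) t)) \<longlongrightarrow> Re (cnj (F z0) * h z0) / norm (F z0)) (at 0)"
      using tendsto_max[OF q2 q1] by simp
  qed (rule eventually_mono[OF qr], use between in blast)+
qed

lemma sup_norm_not_differentiable:
  fixes F :: "complex \<Rightarrow> complex"
  assumes K: "compact K" and F: "continuous_on K F"
    and z: "z1 \<in> max_modulus_set K F" "z2 \<in> max_modulus_set K F" "z1 \<noteq> z2"
  obtains c where "\<And>L. \<not> ((\<lambda>t. (sup_norm K (\<lambda>z. F z + of_real t * (c * (z - z2)))
    - sup_norm K F) / t) \<longlongrightarrow> L) (at (0::real))"
proof -
  \<comment> \<open>\<open>u\<close> is the unit direction of \<open>F z1\<close>, with default 1 if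
    \<open>F z1 = 0\<close>. The factor \<open>c\<close> is scaled so that the perturbing direction
    equals \<open>u\<close> at \<open>z1\<close>; it vanishes at \<open>z2\<close>.\<close>
  define u where "u = (if F z1 = 0 then 1 else sgn (F z1))"
  define c where "c = u / (z1 - z2)"
  define q where "q t = (sup_norm K (\<lambda>z. F z + of_real t * (c * (z - z2))) - sup_norm K F) / t"
    for t :: real
  have z': "z1 \<in> K" "z2 \<in> K" "norm (F z1) = sup_norm K F" "norm (F z2) = sup_norm K F"
    using z unfolding max_modulus_set_def by auto
  have cu: "c * (z1 - z2) = u" using z(3) by (simp add: c_def)
  have u: "norm u = 1" "F z1 = of_real (norm (F z1)) * u"
    by (simp add: u_def norm_sgn) (simp add: u_def sgn_eq)
  have up: "norm (F z + of_real t * (c * (z - z2)))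
      \<le> sup_norm K (\<lambda>z. F z + of_real t * (c * (z - z2)))" if "z \<in> K" for z and t :: real
    using that by (intro norm_le_sup_norm[OF K]) (auto intro!: continuous_intros F)
  \<comment> \<open>At \<open>z1\<close> the perturbation is aligned with \<open>F z1\<close>, so
    the modulus grows by exactly \<open>t\<close>.\<close>
  have right: "q t \<ge> 1" if "t > 0" for t
  proof -
    have "F z1 + of_real t * (c * (z1 - z2)) = of_real (norm (F z1) + t) * u"
      using u(2) cu by (simp add: algebra_simps)
    then have "norm (F z1 + of_real t * (c * (z1 - z2))) = norm (F z1) + t"
      using that u(1) by (simp only: norm_mult norm_of_real) simp
    with up[OF z'(1), of t] z'(3) that show ?thesis
      by (simp add: q_def field_simps)
  qed
  \<comment> \<open>The modulus at \<open>z2\<close> stays unchanged, so the norm cannot drop below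
    its original value.\<close>
  have left: "q t \<le> 0" if "t < 0" for t
    using up[OF z'(2), of t] z'(4) that by (simp add: q_def divide_le_0_iff)
  have "\<not> (q \<longlongrightarrow> L) (at 0)" for L
  proof
    assume L: "(q \<longlongrightarrow> L) (at 0)"
    then have R: "(q \<longlongrightarrow> L) (at_right 0)" and L: "(q \<longlongrightarrow> L) (at_left 0)"
      by (auto intro: filterlim_mono at_le)
    have "1 \<le> L"
      by (rule tendsto_lowerbound[OF R]) (auto simp: eventually_at_filter right)
    moreover have "L \<le> 0"
      by (rule tendsto_upperbound[OF L]) (auto simp: eventually_at_filter left)
    ultimately show False by simp
  qed
  then show thesis unfolding q_def by (rule that)
qed

subsection \<open>Principal parts\<close>

text \<open>At a pole \<open>pole_order\<close> is minus the subdegree of the Laurent series, and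
  elsewhere the subdegree is nonnegative. In both cases the index \<open>- int j\<close> lies below
  the subdegree.\<close>

lemma pp_coeff_eq_0:
  assumes "f meromorphic_on {w}" "1 \<le> j" "\<not> (is_pole f w \<and> j \<le> pole_order f w)"
  shows "pp_coeff f w j = 0"
proof -
  define F where "F = laurent_expansion f w"
  have F: "(\<lambda>x. f (w + x)) has_laurent_expansion F"
    using assms(1) unfolding meromorphic_on_def' F_def by simp
  have "- int j < fls_subdegree F" 
  proof (cases "is_pole f w")
    case True
    then have neg: "fls_subdegree F < 0" using is_pole_fls_subdegree_iff[OF F] by simp
    then have "F \<noteq> 0" by auto
    with True neg assms(3) has_laurent_expansion_zorder[OF F] show ?thesis
      by (auto simp: pole_order_def)
  next
    case False
    then show ?thesis using is_pole_fls_subdegree_iff[OF F] assms(2) by simp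
  qed
  then show ?thesis unfolding pp_coeff_def F_def[symmetric] by (rule fls_eq0_below_subdegree)
qed

text \<open>Laurent expansions are unique and add termwise. Working with a fixed index
  \<open>j\<close> makes this insensitive to cancellations that lower pole orders.\<close>

lemma pp_coeff_linear:
  assumes "f meromorphic_on {w}" "g meromorphic_on {w}"
  shows "pp_coeff (\<lambda>z. f z + c * g z) w j = pp_coeff f w j + c * pp_coeff g w j"
proof -
  have "(\<lambda>x. f (w + x)) has_laurent_expansion laurent_expansion f w"
    "(\<lambda>x. g (w + x)) has_laurent_expansion laurent_expansion g w"
    using assms unfolding meromorphic_on_def' by auto
  then have "(\<lambda>x. f (w + x) + c * g (w + x)) has_laurent_expansion
      (laurent_expansion f w + fls_const c * laurent_expansion g w)"
    by (intro laurent_expansion_intros)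
  then have "laurent_expansion (\<lambda>z. f z + c * g z) w
      = laurent_expansion f w + fls_const c * laurent_expansion g w"
    by (rule laurent_expansion_eqI)
  then show ?thesis by (simp add: pp_coeff_def)
qed

lemma finite_poles_in:
  assumes "compact D" "f meromorphic_on D"
  shows "finite (poles_in D f)"
proof -
  have "{z. is_pole f z} sparse_in D"
    using meromorphic_on_imp_not_pole_cosparse[OF assms(2)] by (simp add: eventually_cosparse)
  from sparse_in_compact_finite[OF this assms(1)] show ?thesis
    by (simp add: poles_in_def Int_def)
qed

lemma pole_order_bounded:
  assumes "compact D" "f meromorphic_on D"
  obtains N where "\<And>w. w \<in> poles_in D f \<Longrightarrow> pole_order f w \<le> N"
  using finite_nat_set_iff_bounded_le[of "pole_order f ` poles_in D f"] finite_poles_in[OF assms]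
  by auto

text \<open>Summing over a larger index set is what makes the principal parts of different functions
  comparable.\<close>

lemma sum_pp_coeff_extend:
  fixes \<phi> :: "complex \<Rightarrow> nat \<Rightarrow> complex"
  assumes f: "f meromorphic_on D" and S: "finite S" "poles_in D f \<subseteq> S" "S \<subseteq> D"
    and N: "\<And>w. w \<in> poles_in D f \<Longrightarrow> pole_order f w \<le> N"
  shows "(\<Sum>w\<in>poles_in D f. \<Sum>j=1..pole_order f w. pp_coeff f w j * \<phi> w j)
    = (\<Sum>w\<in>S. \<Sum>j=1..N. pp_coeff f w j * \<phi> w j)"
proof -
  have f': "f meromorphic_on {w}" if "w \<in> S" for w
    using f that S(3) by (auto intro: meromorphic_on_subset)
  have "(\<Sum>w\<in>poles_in D f. \<Sum>j=1..pole_order f w. pp_coeff f w j * \<phi> w j)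
      = (\<Sum>w\<in>poles_in D f. \<Sum>j=1..N. pp_coeff f w j * \<phi> w j)"
  proof (rule sum.cong[OF refl], rule sum.mono_neutral_left)
    fix w assume w: "w \<in> poles_in D f"
    then show "{1..pole_order f w} \<subseteq> {1..N}" using N by auto
    from w S have "f meromorphic_on {w}" by (intro f') auto
    then show "\<forall>j\<in>{1..N} - {1..pole_order f w}. pp_coeff f w j * \<phi> w j = 0"
      by (auto intro: pp_coeff_eq_0)
  qed auto
  also have "\<dots> = (\<Sum>w\<in>S. \<Sum>j=1..N. pp_coeff f w j * \<phi> w j)"
    using S f' by (intro sum.mono_neutral_left)
      (auto intro!: sum.neutral pp_coeff_eq_0 simp: poles_in_def)
  finally show ?thesis .
qed

text \<open>The weight \<open>\<phi>\<close> treats both parts at once: \<open>(z - w) ^ j\<close>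
  yields \<open>mero_Q\<close> and its inverse yields \<open>mero_P\<close>. Poles of
  \<open>f\<close> and \<open>g\<close> may differ or cancel, so all three sums are first taken over
  a common index set.\<close>

lemma sum_pp_coeff_linear:
  fixes \<phi> :: "complex \<Rightarrow> nat \<Rightarrow> complex"
  assumes D: "compact D" and f: "f meromorphic_on D" and g: "g meromorphic_on D"
  defines "s \<equiv> \<lambda>f. \<Sum>w\<in>poles_in D f. \<Sum>j=1..pole_order f w. pp_coeff f w j * \<phi> w j"
  shows "s (\<lambda>z. f z + c * g z) = s f + c * s g"
proof -
  let ?k = "\<lambda>z. f z + c * g z"
  have k: "?k meromorphic_on D" by (intro meromorphic_intros f g)
  obtain N1 N2 N3 where N: "\<And>w. w \<in> poles_in D f \<Longrightarrow> pole_order f w \<le> N1"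
    "\<And>w. w \<in> poles_in D g \<Longrightarrow> pole_order g w \<le> N2"
    "\<And>w. w \<in> poles_in D ?k \<Longrightarrow> pole_order ?k w \<le> N3"
    using pole_order_bounded[OF D f] pole_order_bounded[OF D g] pole_order_bounded[OF D k]
    by metis
  define N where "N = max N1 (max N2 N3)"
  define S where "S = poles_in D f \<union> poles_in D g \<union> poles_in D ?k"
  have S: "finite S" "S \<subseteq> D" "poles_in D f \<subseteq> S" "poles_in D g \<subseteq> S" "poles_in D ?k \<subseteq> S"
    using finite_poles_in[OF D f] finite_poles_in[OF D g] finite_poles_in[OF D k]
    unfolding S_def by (auto simp: poles_in_def)
  have "s f = (\<Sum>w\<in>S. \<Sum>j=1..N. pp_coeff f w j * \<phi> w j)"
    unfolding s_def by (intro sum_pp_coeff_extend f S) (use N(1) in \<open>force simp: N_def\<close>)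
  moreover have "s g = (\<Sum>w\<in>S. \<Sum>j=1..N. pp_coeff g w j * \<phi> w j)"
    unfolding s_def by (intro sum_pp_coeff_extend g S) (use N(2) in \<open>force simp: N_def\<close>)
  moreover have "s ?k = (\<Sum>w\<in>S. \<Sum>j=1..N. pp_coeff ?k w j * \<phi> w j)"
    unfolding s_def by (intro sum_pp_coeff_extend k S) (use N(3) in \<open>force simp: N_def\<close>)
  moreover have "\<dots> = (\<Sum>w\<in>S. \<Sum>j=1..N. (pp_coeff f w j + c * pp_coeff g w j) * \<phi> w j)"
  proof (intro sum.cong refl)
    fix w j assume "w \<in> S"
    then have "f meromorphic_on {w}" "g meromorphic_on {w}"
      using f g S(2) by (auto intro: meromorphic_on_subset)
    from pp_coeff_linear[OF this]
    show "pp_coeff ?k w j * \<phi> w j = (pp_coeff f w j + c * pp_coeff g w j) * \<phi> w j" by simp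
  qed
  ultimately show ?thesis
    by (simp add: sum_distrib_left sum.distrib[symmetric] algebra_simps)
qed

section \<open>Linearity and continuity of the parts of a meromorphic function\<close>

lemma mero_Q_linear:
  assumes "compact D" "f meromorphic_on D" "g meromorphic_on D"
  shows "mero_Q D (\<lambda>z. f z + c * g z) z = mero_Q D f z + c * mero_Q D g z"
  unfolding mero_Q_def using sum_pp_coeff_linear[OF assms] .

lemma mero_P_linear:
  assumes "compact D" "f meromorphic_on D" "g meromorphic_on D"
  shows "mero_P D (\<lambda>z. f z + c * g z) z = mero_P D f z + c * mero_P D g z"
  using sum_pp_coeff_linear[OF assms, where \<phi> = "\<lambda>w j. inverse ((z - w) ^ j)"]
  by (simp add: mero_P_def divide_inverse)

lemma continuous_on_mero_Q: "continuous_on A (mero_Q D f)"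
  unfolding mero_Q_def by (intro continuous_intros)

lemma meromorphic_on_mero_P: "mero_P D f meromorphic_on A"
  unfolding mero_P_def by (intro meromorphic_intros)

text \<open>Subtracting the principal part at \<open>w\<close> removes all negative Laurent
  coefficients there, and the principal parts at the other poles are continuous at
  \<open>w\<close>.\<close>

lemma tendsto_diff_mero_P:
  assumes D: "compact D" and f: "f meromorphic_on D" and w: "w \<in> D"
  obtains c where "((\<lambda>z. f z - mero_P D f z) \<longlongrightarrow> c) (at w)"
proof -
  obtain N where N: "\<And>w. w \<in> poles_in D f \<Longrightarrow> pole_order f w \<le> N"
    using pole_order_bounded[OF D f] by blast
  \<comment> \<open>Inserting \<open>w\<close> allows its principal part, possibly zero, to be split
    off whether or not \<open>w\<close> is a pole.\<close>
  define S where "S = insert w (poles_in D f)"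
  have S: "finite S" "poles_in D f \<subseteq> S" "S \<subseteq> D"
    using finite_poles_in[OF D f] w by (auto simp: S_def poles_in_def)
  have w_S: "w \<in> S" by (simp add: S_def)
  define p where "p v z = (\<Sum>j=1..N. pp_coeff f v j * inverse ((z - v) ^ j))" for v z
  have P: "mero_P D f z = p w z + (\<Sum>v\<in>S - {w}. p v z)" for z
    using sum_pp_coeff_extend[OF f S N, of "\<lambda>w j. inverse ((z - w) ^ j)"] S(1)
    by (simp add: mero_P_def p_def divide_inverse sum.remove[of S w] w_S)
  define F where "F = laurent_expansion f w"
  have F: "(\<lambda>x. f (w + x)) has_laurent_expansion F"
    using f w unfolding meromorphic_on_def' F_def by simp
  define G where "G = F - (\<Sum>j=1..N. fls_const (pp_coeff f w j) * fls_X_inv ^ j)"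
  have "(\<lambda>x. f (w + x) - (\<Sum>j=1..N. pp_coeff f w j * inverse x ^ j)) has_laurent_expansion G"
    unfolding G_def by (intro laurent_expansion_intros F)
  then have G: "(\<lambda>x. f (w + x) - p w (w + x)) has_laurent_expansion G"
    by (simp add: p_def power_inverse)
  have nth: "fls_nth (\<Sum>j=1..N. fls_const (pp_coeff f w j) * fls_X_inv ^ j) (- int k)
      = (if k \<le> N then pp_coeff f w k else 0)" if "1 \<le> k" for k
  proof -
    have "fls_nth (\<Sum>j=1..N. fls_const (pp_coeff f w j) * fls_X_inv ^ j) (- int k)
        = (\<Sum>j=1..N. if j = k then pp_coeff f w j else 0)"
      by (simp add: fls_nth_sum fls_X_inv_power_conv_shift_1 mult_delta_right)
    with that show ?thesis by simp
  qed
  have "fls_subdegree G \<ge> 0"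
  proof (rule fls_subdegree_ge0I)
    fix n :: int assume "n < 0"
    then obtain k where k: "n = - int k" "1 \<le> k"
      by (metis Suc_leI neg_int_cases One_nat_def)
    \<comment> \<open>Since \<open>N\<close> bounds the pole orders, cutting the principal part off
      at \<open>N\<close> loses no coefficient.\<close>
    have "k > N \<Longrightarrow> pp_coeff f w k = 0"
      using f w k N by (intro pp_coeff_eq_0) (force intro: meromorphic_on_subset simp: poles_in_def)+
    then have "fls_nth F n = (if k \<le> N then pp_coeff f w k else 0)"
      by (auto simp: pp_coeff_def F_def k)
    with nth[OF k(2)] k show "fls_nth G n = 0"
      by (simp add: G_def)
  qed
  from has_laurent_expansion_imp_tendsto[of "\<lambda>z. f z - p w z", OF G this]
  have "((\<lambda>z. f z - p w z) \<longlongrightarrow> fls_nth G 0) (at w)" .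
  moreover have "((\<lambda>z. \<Sum>v\<in>S - {w}. p v z) \<longlongrightarrow> (\<Sum>v\<in>S - {w}. p v w)) (at w)"
    unfolding p_def by (intro tendsto_intros) auto
  ultimately have "((\<lambda>z. (f z - p w z) - (\<Sum>v\<in>S - {w}. p v z))
      \<longlongrightarrow> fls_nth G 0 - (\<Sum>v\<in>S - {w}. p v w)) (at w)"
    by (rule tendsto_diff)
  then show thesis by (intro that) (simp add: P diff_diff_eq)
qed

text \<open>\<open>remove_sings\<close> takes the limit as its value wherever a limit exists.
  Analyticity and linearity of \<open>mero_R\<close> both rest on this description.\<close>

lemma tendsto_mero_R:
  assumes "compact D" "f meromorphic_on D" "w \<in> D"
  shows "((\<lambda>z. f z - mero_P D f z) \<longlongrightarrow> mero_R D f w) (at w)"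
  using tendsto_diff_mero_P[OF assms] unfolding mero_R_def by (metis remove_sings_eqI)

text \<open>An isolated singularity with a finite limit is removable, so filling in the limits gives
  a function analytic at each point of \<open>D\<close>.\<close>

lemma continuous_on_mero_R:
  assumes "compact D" "f meromorphic_on D"
  shows "continuous_on D (mero_R D f)"
proof -
  have "mero_R D f analytic_on {w}" if "w \<in> D" for w
    unfolding mero_R_def
  proof (rule remove_sings_analytic_at)
    show "isolated_singularity_at (\<lambda>z. f z - mero_P D f z) w"
      using that assms(2) meromorphic_on_mero_P
      by (intro meromorphic_on_isolated_singularity meromorphic_intros)
        (auto intro: meromorphic_on_subset)
  qed (rule tendsto_mero_R[OF assms that])
  then have "mero_R D f analytic_on D" using analytic_on_analytic_at by blast
  then show ?thesis by (intro holomorphic_on_imp_continuous_on analytic_imp_holomorphic)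
qed

lemma mero_R_linear:
  assumes "compact D" "f meromorphic_on D" "g meromorphic_on D" "w \<in> D"
  shows "mero_R D (\<lambda>z. f z + c * g z) w = mero_R D f w + c * mero_R D g w"
proof -
  have "((\<lambda>z. (f z - mero_P D f z) + c * (g z - mero_P D g z))
      \<longlongrightarrow> mero_R D f w + c * mero_R D g w) (at w)"
    by (intro tendsto_intros tendsto_mero_R assms)
  then show ?thesis
    unfolding mero_R_def
    by (intro remove_sings_eqI) (simp add: mero_P_linear[OF assms(1-3)] algebra_simps)
qed

section \<open>Directions that change only one part, and the zero element\<close>

lemma mero_Q_mero_R_analytic:
  assumes "g analytic_on D"
  shows "mero_Q D g z = 0" and "w \<in> D \<Longrightarrow> mero_R D g w = g w"
proof -
  have ana: "g analytic_on {v}" if "v \<in> D" for v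
    using assms that by (auto intro: analytic_on_subset)
  then have "poles_in D g = {}"
    using analytic_at_imp_no_pole[of g] by (auto simp: poles_in_def)
  then show "mero_Q D g z = 0" and "w \<in> D \<Longrightarrow> mero_R D g w = g w"
    using ana by (simp_all add: mero_Q_def mero_R_def mero_P_def)
qed

lemma mero_Q_mero_R_simple_pole:
  assumes "compact D" "a \<in> D"
  shows "mero_Q D (\<lambda>z. c / (z - a)) z = c * (z - a)"
    and "w \<in> D \<Longrightarrow> mero_R D (\<lambda>z. c / (z - a)) w = 0"
proof -
  let ?g = "\<lambda>z. c / (z - a)"
  have g: "?g meromorphic_on D" by (intro meromorphic_intros)
  obtain N where N: "\<And>w. w \<in> poles_in D ?g \<Longrightarrow> pole_order ?g w \<le> N"
    using pole_order_bounded[OF assms(1) g] by blast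
  have "is_pole ?g v \<Longrightarrow> v = a" for v
  proof (rule ccontr)
    assume "is_pole ?g v" "v \<noteq> a"
    then have "?g analytic_on {v}" by (intro analytic_intros) auto
    with \<open>is_pole ?g v\<close> show False using analytic_at_imp_no_pole by blast
  qed
  then have S: "finite {a}" "poles_in D ?g \<subseteq> {a}" "{a} \<subseteq> D"
    using assms by (auto simp: poles_in_def)
  have "(\<lambda>x. c * inverse x) has_laurent_expansion fls_const c * fls_X_inv"
    by (intro laurent_expansion_intros)
  then have "laurent_expansion ?g a = fls_const c * fls_X_inv"
    by (intro laurent_expansion_eqI) (simp add: divide_inverse)
  then have pp: "pp_coeff ?g a j = (if j = 1 then c else 0)" for j
    by (auto simp: pp_coeff_def)
  have eq: "(\<Sum>w\<in>poles_in D ?g. \<Sum>j=1..pole_order ?g w. pp_coeff ?g w j * \<phi> w j) = c * \<phi> a 1" 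
    for \<phi>
  proof -
    \<comment> \<open>Raising the bound to \<open>max 1 N\<close> keeps the index 1, the only one
      that can carry a nonzero coefficient, in the range. This also covers \<open>c = 0\<close>,
      where there is no pole.\<close>
    have "w \<in> poles_in D ?g \<Longrightarrow> pole_order ?g w \<le> max 1 N" for w
      using N by (simp add: le_max_iff_disj)
    from sum_pp_coeff_extend[OF g S this, where \<phi> = \<phi>] show ?thesis
      by (simp add: pp mult_delta_left)
  qed
  show "mero_Q D ?g z = c * (z - a)"
    using eq[of "\<lambda>w j. (z - w) ^ j"] by (simp add: mero_Q_def)
  have "mero_P D ?g z = ?g z" for z
    using eq[of "\<lambda>w j. inverse ((z - w) ^ j)"] by (simp add: mero_P_def divide_inverse)
  then show "mero_R D ?g w = 0" if "w \<in> D"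
    by (auto simp: mero_R_def)
qed

text \<open>\<open>mero_eq\<close> controls \<open>f\<close> only on \<open>D\<close> and up to a
  sparse set. Since \<open>w\<close> is a limit point of \<open>D\<close>, zeros of \<open>f\<close>
  still accumulate at \<open>w\<close>, and the identity theorem makes \<open>f\<close> vanish on a
  punctured neighbourhood of \<open>w\<close>.\<close>

lemma mero_eq_0_imp_parts_eq_0:
  assumes "f meromorphic_on D" "\<And>z. z \<in> D \<Longrightarrow> z islimpt D" "mero_eq D f (\<lambda>z. 0)"
  shows "mero_Q D f z = 0" and "w \<in> D \<Longrightarrow> mero_R D f w = 0"
proof -
  have ev: "eventually (\<lambda>z. f z = 0) (at w)" if "w \<in> D" for w
  proof -
    have "\<not> w islimpt {z \<in> D. f z \<noteq> 0}"
      using assms(3) that unfolding mero_eq_def sparse_in_def by auto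
    then have "eventually (\<lambda>z. \<not> (z \<in> D \<and> f z \<noteq> 0)) (at w)"
      by (simp add: islimpt_conv_frequently_at frequently_def)
    moreover have "frequently (\<lambda>z. z \<in> D) (at w)"
      using assms(2)[OF that] by (simp add: islimpt_conv_frequently_at)
    ultimately have fr: "frequently (\<lambda>z. f z = 0) (at w)"
      using frequently_rev_mp[where Q = "\<lambda>z. f z = 0"] by (auto elim: eventually_mono)
    obtain F where F: "(\<lambda>x. f (w + x)) has_laurent_expansion F"
      using assms(1) \<open>w \<in> D\<close> unfolding meromorphic_on_def by blast
    show ?thesis
      using fr has_laurent_expansion_frequently_zero_iff[OF F]
        has_laurent_expansion_eventually_zero_iff[OF F] by simp
  qed
  have "\<not> is_pole f w" if "w \<in> D" for w
    using is_pole_cong[OF ev[OF that] refl] by simp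
  then have no_poles: "poles_in D f = {}" by (auto simp: poles_in_def)
  then show "mero_Q D f z = 0" by (simp add: mero_Q_def)
  show "mero_R D f w = 0" if "w \<in> D"
    unfolding mero_R_def
    by (rule remove_sings_eqI, rule tendsto_eventually)
      (use ev[OF that] no_poles in \<open>simp add: mero_P_def\<close>)
qed

subsection \<open>Differentiability of the norm\<close>

text \<open>The curve is connected with more than one point, and the inside is open; neither has an
  isolated point.\<close>

lemma simple_closed_region_perfect:
  fixes \<gamma> :: "real \<Rightarrow> complex"
  assumes "simple_path \<gamma>" "z \<in> path_image \<gamma> \<union> inside (path_image \<gamma>)"
  shows "z islimpt (path_image \<gamma> \<union> inside (path_image \<gamma>))"
  using assms(2)
proof
  assume z: "z \<in> path_image \<gamma>"
  have "path_image \<gamma> \<noteq> {x}" for x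
    using simple_path_image_uncountable[OF assms(1)] by auto
  with z assms(1) have "z islimpt path_image \<gamma>"
    by (intro connected_imp_perfect connected_simple_path_image) auto
  then show ?thesis by (rule islimpt_subset) auto
next
  assume "z \<in> inside (path_image \<gamma>)"
  moreover have "open (inside (path_image \<gamma>))"
    using assms(1) by (intro open_inside closed_path_image simple_path_imp_path)
  ultimately have "z islimpt inside (path_image \<gamma>)"
    by (intro interior_limit_point) (simp add: interior_open)
  then show ?thesis by (rule islimpt_subset) auto
qed

lemma is_singleton_Times_iff:
  assumes "A \<noteq> {}" "B \<noteq> {}"
  shows "is_singleton (A \<times> B) \<longleftrightarrow> is_singleton A \<and> is_singleton B"
proof
  assume "is_singleton (A \<times> B)"
  then obtain p where "A \<times> B = {p}" by (auto simp: is_singleton_def)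
  then have "fst ` (A \<times> B) = {fst p}" "snd ` (A \<times> B) = {snd p}" by simp_all
  with assms show "is_singleton A \<and> is_singleton B" by (simp add: is_singleton_def)
qed (auto simp: is_singleton_def)

text \<open>On a nonempty compact set without isolated points the question reduces to the two
  supremum norms separately, because each part can be perturbed while the other stays fixed.\<close>

lemma gateaux_differentiable_mero_iff:
  assumes D: "compact D" "D \<noteq> {}" and perfect: "\<And>z. z \<in> D \<Longrightarrow> z islimpt D"
    and f: "f meromorphic_on D"
  shows "gateaux_differentiable_mero D f \<longleftrightarrow>
    is_singleton (max_modulus_set D (mero_Q D f) \<times> max_modulus_set D (mero_R D f))"
proof -
  let ?Q = "mero_Q D f" and ?R = "mero_R D f"
  have Q: "continuous_on D ?Q" and R: "continuous_on D ?R"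
    using continuous_on_mero_Q continuous_on_mero_R[OF D(1) f] by auto
  have quotient: "(mero_norm D (\<lambda>z. f z + of_real t * g z) - mero_norm D f) / t
      = (sup_norm D (\<lambda>z. ?Q z + of_real t * mero_Q D g z) - sup_norm D ?Q) / t
      + (sup_norm D (\<lambda>z. ?R z + of_real t * mero_R D g z) - sup_norm D ?R) / t"
    if g: "g meromorphic_on D" for g and t :: real
  proof -
    have "sup_norm D (mero_R D (\<lambda>z. f z + of_real t * g z))
        = sup_norm D (\<lambda>z. ?R z + of_real t * mero_R D g z)"
      by (intro sup_norm_cong mero_R_linear D f g)
    moreover have "mero_Q D (\<lambda>z. f z + of_real t * g z) = (\<lambda>z. ?Q z + of_real t * mero_Q D g z)"
      by (intro ext mero_Q_linear D f g)
    ultimately show ?thesis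
      by (simp add: mero_norm_def add_divide_distrib[symmetric])
  qed
  have not_singleton: "\<not> is_singleton D"
    using perfect by (auto simp: is_singleton_def islimpt_insert)
  \<comment> \<open>If the maximum modulus were 0, then \<open>F\<close> would vanish on
    \<open>D\<close> and every point of \<open>D\<close> would be a maximizer, but \<open>D\<close>
    has more than one point.\<close>
  have nz: "F z0 \<noteq> 0" if F: "continuous_on D F" and max: "max_modulus_set D F = {z0}" for F z0
  proof
    assume "F z0 = 0"
    moreover have "z0 \<in> max_modulus_set D F" using max by simp
    ultimately have "sup_norm D F = 0" by (simp add: max_modulus_set_def)
    with norm_le_sup_norm[OF D(1) F] have "max_modulus_set D F = D"
      by (intro max_modulus_set_eq_zero) force
    with max not_singleton show False by (simp add: is_singleton_def)
  qed
  have "gateaux_differentiable_mero D f \<longleftrightarrow>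
    is_singleton (max_modulus_set D ?Q) \<and> is_singleton (max_modulus_set D ?R)"
  proof (intro iffI conjI)
    assume G: "gateaux_differentiable_mero D f"
    show "is_singleton (max_modulus_set D ?Q)"
    proof (rule is_singletonI'[OF max_modulus_set_nonempty[OF D Q]], rule ccontr)
      fix z1 z2 assume z: "z1 \<in> max_modulus_set D ?Q" "z2 \<in> max_modulus_set D ?Q" "z1 \<noteq> z2"
      from sup_norm_not_differentiable[OF D(1) Q z] obtain c where
        c: "\<And>L. \<not> ((\<lambda>t. (sup_norm D (\<lambda>z. ?Q z + of_real t * (c * (z - z2)))
          - sup_norm D ?Q) / t) \<longlongrightarrow> L) (at (0::real))" by blast
      have z2: "z2 \<in> D" using z by (simp add: max_modulus_set_def)
      let ?g = "\<lambda>z. c / (z - z2)"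
      have g: "?g meromorphic_on D" by (intro meromorphic_intros)
      \<comment> \<open>The analytic part of \<open>?g\<close> is 0, so the quotient for
        \<open>?R\<close> vanishes and the nonconvergent quotient for \<open>?Q\<close> remains
        alone.\<close>
      have "sup_norm D (\<lambda>z. ?R z + of_real t * mero_R D ?g z) = sup_norm D ?R" for t :: real
        by (intro sup_norm_cong) (simp add: mero_Q_mero_R_simple_pole[OF D(1) z2])
      then have "(\<lambda>t. (mero_norm D (\<lambda>z. f z + of_real t * ?g z) - mero_norm D f) / t)
          = (\<lambda>t. (sup_norm D (\<lambda>z. ?Q z + of_real t * (c * (z - z2))) - sup_norm D ?Q) / t)"
        unfolding quotient[OF g] by (simp add: mero_Q_mero_R_simple_pole[OF D(1) z2])
      moreover from G g obtain L where
        "((\<lambda>t. (mero_norm D (\<lambda>z. f z + of_real t * ?g z) - mero_norm D f) / t)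
          \<longlongrightarrow> L) (at (0::real))"
        unfolding gateaux_differentiable_mero_def by blast
      ultimately show False using c by simp
    qed
    show "is_singleton (max_modulus_set D ?R)"
    proof (rule is_singletonI'[OF max_modulus_set_nonempty[OF D R]], rule ccontr)
      fix z1 z2 assume z: "z1 \<in> max_modulus_set D ?R" "z2 \<in> max_modulus_set D ?R" "z1 \<noteq> z2"
      from sup_norm_not_differentiable[OF D(1) R z] obtain c where
        c: "\<And>L. \<not> ((\<lambda>t. (sup_norm D (\<lambda>z. ?R z + of_real t * (c * (z - z2)))
          - sup_norm D ?R) / t) \<longlongrightarrow> L) (at (0::real))" by blast
      let ?g = "\<lambda>z. c * (z - z2)"
      \<comment> \<open>An analytic direction has zero polynomial part, so here only the quotient
        for \<open>?R\<close> survives.\<close>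
      have ana: "?g analytic_on D" by (intro analytic_intros)
      have g: "?g meromorphic_on D" by (intro meromorphic_intros)
      have "sup_norm D (\<lambda>z. ?R z + of_real t * mero_R D ?g z)
          = sup_norm D (\<lambda>z. ?R z + of_real t * (c * (z - z2)))" for t :: real
        by (intro sup_norm_cong) (simp add: mero_Q_mero_R_analytic[OF ana])
      then have "(\<lambda>t. (mero_norm D (\<lambda>z. f z + of_real t * ?g z) - mero_norm D f) / t)
          = (\<lambda>t. (sup_norm D (\<lambda>z. ?R z + of_real t * (c * (z - z2))) - sup_norm D ?R) / t)"
        unfolding quotient[OF g] by (simp add: mero_Q_mero_R_analytic[OF ana])
      moreover from G g obtain L where
        "((\<lambda>t. (mero_norm D (\<lambda>z. f z + of_real t * ?g z) - mero_norm D f) / t)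
          \<longlongrightarrow> L) (at (0::real))"
        unfolding gateaux_differentiable_mero_def by blast
      ultimately show False using c by simp
    qed
  next
    assume "is_singleton (max_modulus_set D ?Q) \<and> is_singleton (max_modulus_set D ?R)"
    then obtain z1 z2 where z: "max_modulus_set D ?Q = {z1}" "max_modulus_set D ?R = {z2}"
      by (auto simp: is_singleton_def)
    have "\<not> mero_eq D f (\<lambda>z. 0)"
    proof
      assume "mero_eq D f (\<lambda>z. 0)"
      from mero_eq_0_imp_parts_eq_0(1)[OF f perfect this] have "max_modulus_set D ?Q = D"
        by (intro max_modulus_set_eq_zero)
      with z not_singleton show False by (auto simp: is_singleton_def)
    qed
    \<comment> \<open>For an arbitrary direction \<open>g\<close> both quotients converge, and the
      derivative of the norm is the sum of their limits.\<close>
    moreover have "\<exists>L. ((\<lambda>t. (mero_norm D (\<lambda>z. f z + of_real t * g z) - mero_norm D f) / t)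
        \<longlongrightarrow> L) (at (0::real))" if g: "g meromorphic_on D" for g
      unfolding quotient[OF g]
      by (rule exI, rule tendsto_add[OF
          sup_norm_directional_derivative[OF D(1) Q continuous_on_mero_Q z(1) nz[OF Q z(1)]]
          sup_norm_directional_derivative[OF D(1) R continuous_on_mero_R[OF D(1) g] z(2)
            nz[OF R z(2)]]])
    ultimately show "gateaux_differentiable_mero D f"
      by (auto simp: gateaux_differentiable_mero_def)
  qed
  then show ?thesis
    by (simp add: is_singleton_Times_iff max_modulus_set_nonempty[OF D Q]
        max_modulus_set_nonempty[OF D R])
qed

theorem theorem2p6:
  fixes \<gamma> :: "real \<Rightarrow> complex" and D :: "complex set" and f :: "complex \<Rightarrow> complex"
  assumes "simple_path \<gamma>" and "pathfinish \<gamma> = pathstart \<gamma>"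
    and "D = path_image \<gamma> \<union> inside (path_image \<gamma>)"
    and "f meromorphic_on D"
  shows "gateaux_differentiable_mero D f \<longleftrightarrow>
         is_singleton (max_modulus_set D (mero_Q D f) \<times> max_modulus_set D (mero_R D f))"
proof (rule gateaux_differentiable_mero_iff)
  have path: "path \<gamma>" using assms(1) by (rule simple_path_imp_path)
  have "bounded D"
    unfolding assms(3) using path by (simp add: bounded_inside bounded_path_image)
  then show "compact D"
    using closed_path_image_Un_inside[OF path] by (simp add: assms(3) compact_eq_bounded_closed)
  show "D \<noteq> {}" unfolding assms(3) by simp
  show "z islimpt D" if "z \<in> D" for z
    using that simple_closed_region_perfect[OF assms(1)] unfolding assms(3) by blast
qed (fact assms(4))

end
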